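(* Let $\mathcal{F}_1$ and $\mathcal{F}_2$ be free linkages in the plane with length ranges $[l_{11},l_{12}]$ and $[l_{21},l_{22}]$ respectively. Let $\mathcal{F}_3$ be a free linkage consisting of two edges of lengths $a$ and $b$, where $|a-b|=\max\{l_{11},l_{21}\}>0$ and $a+b>\min\{l_{12},l_{22}\}$. Then the moduli space $M(\mathcal{F}_1,\mathcal{F}_2,\mathcal{F}_3)$ is (homeomorphic to) the disjoint union of two copies of $M(\mathcal{F}_1,\mathcal{F}_2)$ modulo the subspace $M_0'$ of $M(\mathcal{F}_1,\mathcal{F}_2)$ where the angle between $a$ and $b$ is $0$; that is, the two copies of $M(\mathcal{F}_1,\mathcal{F}_2)$ are glued together along their copies of $M_0'$.
   Context: A free linkage $\mathcal{F}$ in $\mathbb{R}^2$ with length vector $(d_1,\ldots,d_n)$, $d_i>0$, has configurations $(x_1,\ldots,x_{n+1})\in(\mathbb{R}^2)^{n+1}$ with $|x_i-x_{i+1}|=d_i$ for $i=1,\ldots,n$; $x_1$ is the initial and $x_{n+1}$ the terminal vertex. For free linkages $\mathcal{F}_1,\ldots,\mathcal{F}_r$, $C(\mathcal{F}_1,\ldots,\mathcal{F}_r)$ is the space of $r$-tuples of configurations with all initial vertices at the origin and all terminal vertices coinciding, and $M(\mathcal{F}_1,\ldots,\mathcal{F}_r)=C(\mathcal{F}_1,\ldots,\mathcal{F}_r)/SO(2)$. The length range of a free linkage is the closed interval $[l_1,l_2]$, where $l_1$ is the minimum of $|x_{n+1}-x_1|$ over all its configurations and $l_2=\sum_{i=1}^n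 d_i$. The angle between $a$ and $b$ is the angle at the middle vertex of $\mathcal{F}_3$; it is $0$ exactly when the two edges are folded onto one another. Thus $M_0'\subset M(\mathcal{F}_1,\mathcal{F}_2)$ consists of the configurations in which the distance between the common initial vertex and the common terminal vertex equals $|a-b|$. *)

theory Defs
  imports "HOL-Analysis.Analysis"
begin

section \<open>Quotients and doubles of topological spaces\<close>

definition quotient_topology :: "'a topology \<Rightarrow> ('a \<times> 'a) set \<Rightarrow> 'a set topology" where
  "quotient_topology X R =
     topology (\<lambda>U. U \<subseteq> topspace X // R \<and> openin X {x \<in> topspace X. R `` {x} \<in> U})"

lemma openin_quotient_topology:
  "openin (quotient_topology X R) U \<longleftrightarrow>
     U \<subseteq> topspace X // R \<and> openin X {x \<in> topspace X. R `` {x} \<in> U}"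
proof -
  have "istopology (\<lambda>U. U \<subseteq> topspace X // R \<and> openin X {x \<in> topspace X. R `` {x} \<in> U})"
    unfolding istopology_def
  proof (intro conjI allI impI)
    fix S T
    assume "S \<subseteq> topspace X // R \<and> openin X {x \<in> topspace X. R `` {x} \<in> S}"
      and "T \<subseteq> topspace X // R \<and> openin X {x \<in> topspace X. R `` {x} \<in> T}"
    moreover have "{x \<in> topspace X. R `` {x} \<in> S \<inter> T} =
        {x \<in> topspace X. R `` {x} \<in> S} \<inter> {x \<in> topspace X. R `` {x} \<in> T}"
      by auto
    ultimately show "S \<inter> T \<subseteq> topspace X // R"
      and "openin X {x \<in> topspace X. R `` {x} \<in> S \<inter> T}"
      by (auto simp: openin_Int)
  next
    fix K
    assume K: "\<forall>S\<in>K. S \<subseteq> topspace X // R \<and> openin X {x \<in> topspace X. R `` {x} \<in> S}"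
    then show "\<Union>K \<subseteq> topspace X // R" by blast
    have "{x \<in> topspace X. R `` {x} \<in> \<Union>K} = (\<Union>S\<in>K. {x \<in> topspace X. R `` {x} \<in> S})"
      by auto
    then show "openin X {x \<in> topspace X. R `` {x} \<in> \<Union>K}"
      using K by auto
  qed
  then show ?thesis
    by (simp add: quotient_topology_def)
qed

lemma topspace_quotient_topology [simp]:
  "topspace (quotient_topology X R) = topspace X // R"
proof
  show "topspace (quotient_topology X R) \<subseteq> topspace X // R"
    using openin_quotient_topology[of X R "topspace (quotient_topology X R)"] by simp
  have "{x \<in> topspace X. R `` {x} \<in> topspace X // R} = topspace X"
    by (auto simp: quotient_def)
  then have "openin (quotient_topology X R) (topspace X // R)"
    by (simp add: openin_quotient_topology)
  then show "topspace X // R \<subseteq> topspace (quotient_topology X R)"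
    by (rule openin_subset)
qed

lemma quotient_map_quotient_topology:
  "quotient_map X (quotient_topology X R) (\<lambda>x. R `` {x})"
  unfolding quotient_map_def by (auto simp: openin_quotient_topology quotient_def)

text \<open>Only the points of \<open>A\<close> are identified with their twins in the other copy; the
  subspace \<open>A\<close> itself is not collapsed.\<close>

definition double_rel :: "'a topology \<Rightarrow> 'a set \<Rightarrow> ((bool \<times> 'a) \<times> (bool \<times> 'a)) set" where
  "double_rel X A = {((s, p), (t, q)).
     p \<in> topspace X \<and> q \<in> topspace X \<and> p = q \<and> (s = t \<or> p \<in> A)}"

lemma equiv_double_rel: "equiv (topspace (sum_topology (\<lambda>_::bool. X) UNIV)) (double_rel X A)"
  by (auto simp: equiv_def refl_on_def sym_def trans_def double_rel_def)

definition double_along :: "'a topology \<Rightarrow> 'a set \<Rightarrow> (bool \<times> 'a) set topology" where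
  "double_along X A = quotient_topology (sum_topology (\<lambda>_::bool. X) UNIV) (double_rel X A)"


section \<open>Linkages in the plane\<close>

text \<open>A free linkage is given by its length vector. Vertices are numbered from \<open>0\<close>, so a linkage
  \<open>d\<close> has vertices \<open>0, \<dots>, length d\<close>, and its edge \<open>i\<close>, of length \<open>d ! i\<close>, joins the vertices
  \<open>i\<close> and \<open>Suc i\<close>. Finite tuples are extensional functions, as \<open>product_topology\<close> requires.\<close>

type_synonym plane = "real ^ 2"

definition free_linkage :: "real list \<Rightarrow> bool" where
  "free_linkage d \<longleftrightarrow> d \<noteq> [] \<and> (\<forall>i < length d. 0 < d ! i)"

definition configs :: "real list \<Rightarrow> (nat \<Rightarrow> plane) set" where
  "configs d = {x \<in> {..length d} \<rightarrow>\<^sub>E UNIV. \<forall>i < length d. dist (x i) (x (Suc i)) = d ! i}"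

definition min_length :: "real list \<Rightarrow> real" where
  "min_length d = (LEAST l. \<exists>x \<in> configs d. l = dist (x (length d)) (x 0))"

definition max_length :: "real list \<Rightarrow> real" where
  "max_length d = (\<Sum>i < length d. d ! i)"

definition length_range :: "real list \<Rightarrow> real set" where
  "length_range d = {min_length d..max_length d}"

definition joint_configs :: "real list list \<Rightarrow> (nat \<Rightarrow> nat \<Rightarrow> plane) set" where
  "joint_configs F = {x \<in> (\<Pi>\<^sub>E j \<in> {..<length F}. configs (F ! j)).
     (\<forall>j < length F. x j 0 = 0) \<and>
     (\<forall>j < length F. \<forall>k < length F. x j (length (F ! j)) = x k (length (F ! k)))}"

definition joint_config_space :: "real list list \<Rightarrow> (nat \<Rightarrow> nat \<Rightarrow> plane) topology" where
  "joint_config_space F = subtopology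
     (product_topology (\<lambda>j. product_topology (\<lambda>_. euclidean) {..length (F ! j)}) {..<length F})
     (joint_configs F)"

definition SO2_rel ::
  "real list list \<Rightarrow> ((nat \<Rightarrow> nat \<Rightarrow> plane) \<times> (nat \<Rightarrow> nat \<Rightarrow> plane)) set" where
  "SO2_rel F = {(x, y). x \<in> joint_configs F \<and> y \<in> joint_configs F \<and>
     (\<exists>A :: real^2^2. rotation_matrix A \<and>
        (\<forall>j < length F. \<forall>i \<le> length (F ! j). y j i = A *v x j i))}"

definition moduli_space :: "real list list \<Rightarrow> (nat \<Rightarrow> nat \<Rightarrow> plane) set topology" where
  "moduli_space F = quotient_topology (joint_config_space F) (SO2_rel F)"

lemma topspace_joint_config_space: "topspace (joint_config_space F) = joint_configs F"
proof -
  have sub: "configs d \<subseteq> {..length d} \<rightarrow>\<^sub>E UNIV" for d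
    by (rule subsetI) (unfold configs_def, elim CollectE conjE, assumption)
  have "joint_configs F \<subseteq>
      (\<Pi>\<^sub>E j \<in> {..<length F}. {..length (F ! j)} \<rightarrow>\<^sub>E UNIV)"
  proof
    fix x assume "x \<in> joint_configs F"
    then have "x \<in> (\<Pi>\<^sub>E j \<in> {..<length F}. configs (F ! j))"
      unfolding joint_configs_def by (elim CollectE conjE)
    then show "x \<in> (\<Pi>\<^sub>E j \<in> {..<length F}. {..length (F ! j)} \<rightarrow>\<^sub>E UNIV)"
      using PiE_mono[OF sub] by (rule rev_subsetD)
  qed
  then show ?thesis
    unfolding joint_config_space_def topspace_subtopology topspace_product_topology
      o_def topspace_euclidean
    by (rule Int_absorb1)
qed

lemma equiv_SO2_rel: "equiv (joint_configs F) (SO2_rel F)"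
proof (rule equivI)
  show "SO2_rel F \<subseteq> joint_configs F \<times> joint_configs F"
    by (auto simp: SO2_rel_def)
  have "rotation_matrix (mat 1 :: real^2^2)"
    by (simp add: rotation_matrix_def orthogonal_matrix_id)
  then show "refl_on (joint_configs F) (SO2_rel F)"
    unfolding refl_on_def SO2_rel_def
    by (auto intro!: exI[of _ "mat 1 :: real^2^2"] simp: matrix_vector_mul_lid)
  show "sym (SO2_rel F)"
  proof (rule symI)
    fix x y assume "(x, y) \<in> SO2_rel F"
    then obtain A :: "real^2^2" where xy: "x \<in> joint_configs F" "y \<in> joint_configs F"
      and A: "rotation_matrix A" "\<forall>j < length F. \<forall>i \<le> length (F ! j). y j i = A *v x j i"
      by (auto simp: SO2_rel_def)
    have "rotation_matrix (transpose A)"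
      using A(1) by (simp add: rotation_matrix_def orthogonal_matrix_transpose det_transpose)
    moreover have "transpose A *v (A *v v) = v" for v
      using A(1) by (simp add: rotation_matrix_def orthogonal_matrix matrix_vector_mul_assoc)
    ultimately show "(y, x) \<in> SO2_rel F"
      using xy A(2) by (auto simp: SO2_rel_def intro!: exI[of _ "transpose A"])
  qed
  show "trans (SO2_rel F)"
  proof (rule transI)
    fix x y z assume "(x, y) \<in> SO2_rel F" "(y, z) \<in> SO2_rel F"
    then obtain A B :: "real^2^2" where xz: "x \<in> joint_configs F" "z \<in> joint_configs F"
      and A: "rotation_matrix A" "\<forall>j < length F. \<forall>i \<le> length (F ! j). y j i = A *v x j i"
      and B: "rotation_matrix B" "\<forall>j < length F. \<forall>i \<le> length (F ! j). z j i = B *v y j i"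
      by (auto simp: SO2_rel_def)
    have "rotation_matrix (B ** A)"
      using A(1) B(1) by (simp add: rotation_matrix_def orthogonal_matrix_mul det_mul)
    then show "(x, z) \<in> SO2_rel F"
      using xz A(2) B(2)
      by (auto simp: SO2_rel_def matrix_vector_mul_assoc intro!: exI[of _ "B ** A"])
  qed
qed

definition vertex_angle :: "plane \<Rightarrow> plane \<Rightarrow> plane \<Rightarrow> real" where
  "vertex_angle p q r = arccos (((p - q) \<bullet> (r - q)) / (norm (p - q) * norm (r - q)))"

text \<open>A point of the moduli space of \<open>F1\<close> and \<open>F2\<close> has no vertices of the two-edge linkage
  \<open>[a, b]\<close>; its angle is read off from a configuration of \<open>[a, b]\<close> with the same end points.\<close>

definition zero_angle_locus ::
  "real list \<Rightarrow> real list \<Rightarrow> real \<Rightarrow> real \<Rightarrow> (nat \<Rightarrow> nat \<Rightarrow> plane) set set" where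
  "zero_angle_locus F1 F2 a b =
     {SO2_rel [F1, F2] `` {x} | x. x \<in> joint_configs [F1, F2] \<and>
        (\<exists>y \<in> configs [a, b]. y 0 = x 0 0 \<and> y 2 = x 0 (length F1) \<and>
           vertex_angle (y 0) (y 1) (y 2) = 0)}"

lemma vertex_angle_eq_0_iff:
  assumes "p \<noteq> q" "r \<noteq> q"
  shows "vertex_angle p q r = 0 \<longleftrightarrow> dist p r = \<bar>dist p q - dist q r\<bar>"
proof -
  define u v where "u = p - q" and "v = r - q"
  have nz: "norm u > 0" "norm v > 0" using assms by (auto simp: u_def v_def)
  have bd: "\<bar>(u \<bullet> v) / (norm u * norm v)\<bar> \<le> 1"
    using Cauchy_Schwarz_ineq2[of u v] nz by (simp add: abs_mult divide_simps)
  have "vertex_angle p q r = 0 \<longleftrightarrow> (u \<bullet> v) / (norm u * norm v) = 1"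
    using arccos_eq_iff[of "(u \<bullet> v) / (norm u * norm v)" 1] bd
    by (auto simp: vertex_angle_def u_def v_def)
  also have "\<dots> \<longleftrightarrow> u \<bullet> v = norm u * norm v" using nz by (simp add: divide_simps)
  also have "\<dots> \<longleftrightarrow> (norm (u - v))\<^sup>2 = (norm u - norm v)\<^sup>2"
    by (auto simp: power2_norm_eq_inner inner_diff power2_diff inner_commute)
  also have "\<dots> \<longleftrightarrow> norm (u - v) = \<bar>norm u - norm v\<bar>"
    using power2_eq_iff_nonneg[of "norm (u - v)" "\<bar>norm u - norm v\<bar>"] by simp
  finally show ?thesis
    by (simp add: u_def v_def dist_norm norm_minus_commute)
qed

lemma zero_angle_locus_eq:
  assumes "a > 0" "b > 0" "a \<noteq> b"
  shows "zero_angle_locus F1 F2 a b =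
     {SO2_rel [F1, F2] `` {x} | x. x \<in> joint_configs [F1, F2] \<and>
        dist (x 0 0) (x 0 (length F1)) = \<bar>a - b\<bar>}"
proof -
  have "(\<exists>y \<in> configs [a, b]. y 0 = p \<and> y 2 = r \<and> vertex_angle (y 0) (y 1) (y 2) = 0)
      \<longleftrightarrow> dist p r = \<bar>a - b\<bar>" for p r
  proof
    assume "\<exists>y \<in> configs [a, b]. y 0 = p \<and> y 2 = r \<and> vertex_angle (y 0) (y 1) (y 2) = 0"
    then obtain y where y: "y \<in> configs [a, b]" "y 0 = p" "y 2 = r"
      "vertex_angle p (y 1) r = 0" by metis
    then have "dist p (y 1) = a" "dist (y 1) r = b"
      by (auto simp: configs_def less_Suc_eq numeral_2_eq_2)
    then show "dist p r = \<bar>a - b\<bar>"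
      using vertex_angle_eq_0_iff[of p "y 1" r] y(4) assms by auto
  next
    assume d: "dist p r = \<bar>a - b\<bar>"
    define q where "q = p + (a / (a - b)) *\<^sub>R (r - p)"
    define y where "y = (\<lambda>i\<in>{..2::nat}. if i = 0 then p else if i = 1 then q else r)"
    have "p - q = (- a / (a - b)) *\<^sub>R (r - p)" by (simp add: q_def)
    then have pq: "dist p q = a"
      using assms d by (simp add: dist_norm norm_minus_commute)
    have "(r - p) - (a / (a - b)) *\<^sub>R (r - p) = (1 - a / (a - b)) *\<^sub>R (r - p)"
      by (simp add: scaleR_left_diff_distrib)
    moreover have "1 - a / (a - b) = - b / (a - b)" using assms by (simp add: divide_simps)
    ultimately have "r - q = (- b / (a - b)) *\<^sub>R (r - p)"
      by (simp add: q_def algebra_simps)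
    then have qr: "dist q r = b"
      using assms d by (simp add: dist_norm norm_minus_commute[of q r] norm_minus_commute[of p r])
    have "y \<in> configs [a, b]"
      using pq qr by (auto simp: configs_def y_def less_Suc_eq numeral_2_eq_2)
    moreover have "vertex_angle p q r = 0"
      using vertex_angle_eq_0_iff[of p q r] pq qr d assms by auto
    ultimately show
      "\<exists>y \<in> configs [a, b]. y 0 = p \<and> y 2 = r \<and> vertex_angle (y 0) (y 1) (y 2) = 0"
      by (intro bexI[of _ y]) (auto simp: y_def)
  qed
  then show ?thesis by (simp add: zero_angle_locus_def)
qed

end

theory Submission
  imports Defs
begin

text \<open>
  In a joint configuration of \<open>F1\<close>, \<open>F2\<close> and \<open>[a, b]\<close>, the two-edge linkage adds only its
  middle vertex \<open>m\<close> to the configuration of \<open>F1\<close> and \<open>F2\<close>. If \<open>t\<close> is the common terminal vertex,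
  \<open>m\<close> is an apex of a triangle with base from \<open>0\<close> to \<open>t\<close> and sides \<open>a\<close>, \<open>b\<close>. The bounds on
  the length ranges say that \<open>\<bar>a - b\<bar> \<le> norm t < a + b\<close> for every configuration of \<open>F1\<close> and
  \<open>F2\<close>. So this triangle always exists; it has exactly two mirror-image apexes, except that they
  coincide when \<open>norm t = \<bar>a - b\<bar>\<close>. The other degenerate case \<open>norm t = a + b\<close>, in which the
  two edges are stretched, is excluded by the strict upper bound. Moreover
  \<open>t \<noteq> 0\<close> as \<open>\<bar>a - b\<bar> > 0\<close>, so both apexes are continuous functions \<open>hinge a b s t\<close> of \<open>t\<close>,
  one for each side \<open>s\<close> of the base line.

  Completing a configuration by either apex maps two copies of the space of configurations of
  \<open>F1\<close> and \<open>F2\<close> onto that of \<open>F1\<close>, \<open>F2\<close> and \<open>[a, b]\<close>. This is a quotient map, because forgetting \<open>m\<close>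
  inverts it on each of two closed pieces, those with \<open>m\<close> weakly on a given side of the base line
  (\<open>quotient_map_from_sections\<close>). Dividing by rotations gives a quotient map onto
  \<open>M(F1, F2, [a, b])\<close>. On the other hand, dividing each copy by rotations and then gluing
  gives a quotient map from the same two copies onto the double of \<open>M(F1, F2)\<close>. Rotations
  preserve sides, so both maps identify the same points (\<open>SO2_rel_attach_iff\<close>): two configurations
  that differ by a rotation and either lie in the same copy or have \<open>norm t = \<bar>a - b\<bar>\<close>. Quotient
  maps from one space with the same fibres have homeomorphic targets
  (\<open>quotient_maps_with_same_fibres\<close>).

  The argument is carried out for a nonempty list \<open>F\<close> of linkages in place of \<open>[F1, F2]\<close>.
\<close>

section \<open>Quotient maps\<close>

lemma quotient_maps_with_same_fibres:
  assumes f: "quotient_map X Y f" and g: "quotient_map X Z g"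
    and fib: "\<And>x y. \<lbrakk>x \<in> topspace X; y \<in> topspace X\<rbrakk> \<Longrightarrow> f x = f y \<longleftrightarrow> g x = g y"
  shows "Y homeomorphic_space Z"
proof -
  obtain h where h: "continuous_map Y Z h" "\<And>x. x \<in> topspace X \<Longrightarrow> h (f x) = g x"
    using quotient_map_lift_exists[OF f quotient_imp_continuous_map[OF g]] fib by metis
  obtain k where k: "continuous_map Z Y k" "\<And>x. x \<in> topspace X \<Longrightarrow> k (g x) = f x"
    using quotient_map_lift_exists[OF g quotient_imp_continuous_map[OF f]] fib by metis
  have "\<exists>x\<in>topspace X. y = f x" if "y \<in> topspace Y" for y
    using f that by (auto simp: quotient_map_def)
  then have kh: "k (h y) = y" if "y \<in> topspace Y" for y
    using h(2) k(2) that by metis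
  have "\<exists>x\<in>topspace X. z = g x" if "z \<in> topspace Z" for z
    using g that by (auto simp: quotient_map_def)
  then have hk: "h (k z) = z" if "z \<in> topspace Z" for z
    using h(2) k(2) that by metis
  have "homeomorphic_maps Y Z h k"
    using h(1) k(1) kh hk by (simp add: homeomorphic_maps_def)
  then show ?thesis
    by (auto simp: homeomorphic_space_def)
qed

text \<open>Openness in a sum is tested summand by summand, and so is openness of a preimage in a sum.\<close>
lemma quotient_map_sum_topology:
  assumes q: "\<And>i. i \<in> I \<Longrightarrow> quotient_map (X i) (Y i) (q i)"
  shows "quotient_map (sum_topology X I) (sum_topology Y I) (\<lambda>(i, x). (i, q i x))"
  unfolding quotient_map_def
proof (intro conjI allI impI)
  show "(\<lambda>(i, x). (i, q i x)) ` topspace (sum_topology X I) = topspace (sum_topology Y I)"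
    using q by (fastforce simp: quotient_map_def image_iff)
next
  fix U assume U: "U \<subseteq> topspace (sum_topology Y I)"
  have "openin (X i) {x \<in> topspace (X i). (i, q i x) \<in> U} \<longleftrightarrow> openin (Y i) {y. (i, y) \<in> U}"
    if "i \<in> I" for i
  proof -
    have "{y. (i, y) \<in> U} \<subseteq> topspace (Y i)" using U by auto
    moreover have "\<forall>V\<subseteq>topspace (Y i).
        openin (X i) {x \<in> topspace (X i). q i x \<in> V} = openin (Y i) V"
      using q[OF that] by (simp add: quotient_map_def)
    ultimately have "openin (X i) {x \<in> topspace (X i). q i x \<in> {y. (i, y) \<in> U}} =
        openin (Y i) {y. (i, y) \<in> U}"
      by blast
    then show ?thesis by simp
  qed
  moreover have "{x. (i, x) \<in> {p \<in> topspace (sum_topology X I). (case p of (i, x) \<Rightarrow> (i, q i x)) \<in> U}}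
      = {x \<in> topspace (X i). (i, q i x) \<in> U}" if "i \<in> I" for i
    using that by auto
  ultimately show "openin (sum_topology X I)
        {p \<in> topspace (sum_topology X I). (case p of (i, x) \<Rightarrow> (i, q i x)) \<in> U}
      \<longleftrightarrow> openin (sum_topology Y I) U"
    using U by (auto simp: openin_sum_topology)
qed

text \<open>Gluing along closed sets: \<open>g i\<close> identifies \<open>X\<close> with the closed piece \<open>C i\<close> of \<open>Y\<close>, the
  restriction of \<open>r\<close> being the inverse. The image of a closed set under \<open>g i\<close> is then the preimage
  under \<open>r\<close> cut down to \<open>C i\<close>, so that all the \<open>g i\<close> together form a closed map.\<close>
lemma quotient_map_from_sections:
  assumes fin: "finite I"
    and r: "continuous_map Y X r"
    and g: "\<And>i. i \<in> I \<Longrightarrow> continuous_map X Y (g i)"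
    and rg: "\<And>i x. \<lbrakk>i \<in> I; x \<in> topspace X\<rbrakk> \<Longrightarrow> r (g i x) = x"
    and C: "\<And>i. i \<in> I \<Longrightarrow> closedin Y (C i)" "(\<Union>i\<in>I. C i) = topspace Y"
    and im: "\<And>i x. \<lbrakk>i \<in> I; x \<in> topspace X\<rbrakk> \<Longrightarrow> g i x \<in> C i"
    and gr: "\<And>i y. \<lbrakk>i \<in> I; y \<in> C i\<rbrakk> \<Longrightarrow> g i (r y) = y"
  shows "quotient_map (sum_topology (\<lambda>_. X) I) Y (\<lambda>(i, x). g i x)"
proof (rule continuous_closed_imp_quotient_map)
  have CY: "C i \<subseteq> topspace Y" if "i \<in> I" for i
    using C that by auto
  have rX: "r y \<in> topspace X" if "y \<in> topspace Y" for y
    using r that by (auto simp: continuous_map_def)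
  have gY: "g i x \<in> topspace Y" if "i \<in> I" "x \<in> topspace X" for i x
    using im CY that by blast
  show "continuous_map (sum_topology (\<lambda>_. X) I) Y (\<lambda>(i, x). g i x)"
    unfolding continuous_map_def
  proof (intro conjI allI impI)
    show "(\<lambda>(i, x). g i x) \<in> topspace (sum_topology (\<lambda>_. X) I) \<rightarrow> topspace Y"
      using gY by auto
    fix U assume U: "openin Y U"
    have "openin X {x \<in> topspace X. g i x \<in> U}" if "i \<in> I" for i
      using g[OF that] U by (auto simp: continuous_map_def)
    then show "openin (sum_topology (\<lambda>_. X) I)
        {p \<in> topspace (sum_topology (\<lambda>_. X) I). (case p of (i, x) \<Rightarrow> g i x) \<in> U}"
      by (auto simp: openin_sum_topology)
  qed
  show "closed_map (sum_topology (\<lambda>_. X) I) Y (\<lambda>(i, x). g i x)"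
    unfolding closed_map_def
  proof (intro allI impI)
    fix K assume K: "closedin (sum_topology (\<lambda>_. X) I) K"
    define K' where "K' i = {x. (i, x) \<in> K}" for i
    have K': "closedin X (K' i)" if "i \<in> I" for i
      using K that by (auto simp: closedin_sum_topology K'_def)
    have K'X: "K' i \<subseteq> topspace X" if "i \<in> I" for i
      using K'[OF that] closedin_subset by blast
    have "K \<subseteq> Sigma I (topspace \<circ> (\<lambda>_. X))"
      using K by (auto simp: closedin_sum_topology)
    then have "(\<lambda>(i, x). g i x) ` K = (\<Union>i\<in>I. g i ` K' i)"
      by (fastforce simp: K'_def)
    also have "\<dots> = (\<Union>i\<in>I. C i \<inter> {y \<in> topspace Y. r y \<in> K' i})"
    proof (intro SUP_cong refl equalityI subsetI)
      fix i y assume i: "i \<in> I" and "y \<in> g i ` K' i"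
      then obtain x where "x \<in> K' i" "y = g i x" by auto
      then show "y \<in> C i \<inter> {y \<in> topspace Y. r y \<in> K' i}"
        using i K'X[OF i] im gY rg by auto
    next
      fix i y assume i: "i \<in> I" and "y \<in> C i \<inter> {y \<in> topspace Y. r y \<in> K' i}"
      then show "y \<in> g i ` K' i"
        using gr[OF i, of y] by force
    qed
    also have "closedin Y \<dots>"
      using fin C(1) closedin_continuous_map_preimage[OF r K']
      by (intro closedin_Union finite_imageI) auto
    finally show "closedin Y ((\<lambda>(i, x). g i x) ` K)" .
  qed
  show "(\<lambda>(i, x). g i x) ` topspace (sum_topology (\<lambda>_. X) I) = topspace Y"
  proof (intro equalityI subsetI)
    fix y assume y: "y \<in> topspace Y"
    then obtain i where "i \<in> I" "y \<in> C i" using C(2) by auto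
    then have "y = (\<lambda>(i, x). g i x) (i, r y)" "(i, r y) \<in> topspace (sum_topology (\<lambda>_. X) I)"
      using gr rX[OF y] by auto
    then show "y \<in> (\<lambda>(i, x). g i x) ` topspace (sum_topology (\<lambda>_. X) I)" by blast
  qed (use gY in auto)
qed

section \<open>The length range of a free linkage\<close>

text \<open>The last edge may point in any direction, independently of the other edges. Hence the set of
  end-to-end displacements is a Minkowski sum of circles, which makes it compact.\<close>
lemma endpoint_displacements_snoc:
  "{x (length (d @ [e])) - x 0 | x. x \<in> configs (d @ [e])} =
     {u + v | u v. u \<in> {x (length d) - x 0 | x. x \<in> configs d} \<and> v \<in> sphere 0 e}"
    (is "?L = ?R")
proof (intro equalityI subsetI)
  fix w assume "w \<in> ?L"
  then obtain x where x: "x \<in> configs (d @ [e])" "w = x (Suc (length d)) - x 0" by auto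
  have ed: "dist (x i) (x (Suc i)) = (d @ [e]) ! i" if "i < Suc (length d)" for i
    using x(1) that by (simp add: configs_def)
  have "restrict x {..length d} \<in> configs d"
    using ed by (auto simp: configs_def nth_append split: if_splits)
  moreover have "x (Suc (length d)) - x (length d) \<in> sphere 0 e"
    using ed[of "length d"] by (simp add: dist_norm norm_minus_commute)
  ultimately show "w \<in> ?R"
    unfolding x(2)
    by (intro CollectI exI[of _ "x (length d) - x 0"] exI[of _ "x (Suc (length d)) - x (length d)"])
       (auto intro!: exI[of _ "restrict x {..length d}"])
next
  fix w assume "w \<in> ?R"
  then obtain x v where x: "x \<in> configs d" and v: "norm v = e" and w: "w = x (length d) - x 0 + v"
    by auto
  define y where "y = x(Suc (length d) := x (length d) + v)"
  have ext: "x i = undefined" if "\<not> i \<le> length d" for i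
    using x that by (auto simp: configs_def PiE_iff extensional_def)
  have "y \<in> configs (d @ [e])"
    using x v ext
    by (auto simp: configs_def y_def PiE_iff extensional_def nth_append less_Suc_eq dist_norm)
  then show "w \<in> ?L"
    by (auto simp: w y_def intro!: exI[of _ y])
qed

lemma compact_endpoint_displacements:
  "compact {x (length d) - x 0 | x. x \<in> configs d}"
proof (induction d rule: rev_induct)
  case Nil
  have "{x (length []) - x 0 | x. x \<in> configs []} \<subseteq> {0}" by auto
  then show ?case using finite_subset[of _ "{0 :: plane}"] finite_imp_compact by blast
next
  case (snoc e d)
  show ?case
    unfolding endpoint_displacements_snoc
    using compact_sums[OF snoc compact_sphere] .
qed

text \<open>On the reals, \<open>LEAST\<close> is meaningful only if the minimum is attained; compactness of the
  set of displacements provides that.\<close>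
lemma min_length_le:
  assumes "x \<in> configs d"
  shows "min_length d \<le> dist (x (length d)) (x 0)"
proof -
  define D where "D = norm ` {x (length d) - x 0 | x. x \<in> configs d}"
  have D: "l \<in> D \<longleftrightarrow> (\<exists>x\<in>configs d. l = dist (x (length d)) (x 0))" for l
    by (auto simp: D_def dist_norm)
  have "compact D"
    unfolding D_def
    by (intro compact_continuous_image compact_endpoint_displacements continuous_intros)
  moreover have "D \<noteq> {}" using assms by (auto simp: D_def)
  ultimately obtain m where m: "m \<in> D" "\<And>l. l \<in> D \<Longrightarrow> m \<le> l"
    using compact_attains_inf by metis
  have "min_length d = (LEAST l. l \<in> D)" by (simp add: min_length_def D)
  also have "\<dots> = m" using m by (intro Least_equality)
  finally show ?thesis using m(2) D assms by blast
qed

lemma le_max_length: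
  assumes "x \<in> configs d"
  shows "dist (x (length d)) (x 0) \<le> max_length d"
proof -
  have "dist (x n) (x 0) \<le> (\<Sum>i<n. d ! i)" if "n \<le> length d" for n
    using that
  proof (induction n)
    case (Suc n)
    have "dist (x (Suc n)) (x 0) \<le> dist (x n) (x (Suc n)) + dist (x n) (x 0)"
      by (rule dist_triangle3)
    also have "dist (x n) (x (Suc n)) = d ! n"
      using assms Suc.prems by (simp add: configs_def)
    finally show ?case using Suc by simp
  qed simp
  then show ?thesis by (simp add: max_length_def)
qed

text \<open>A configuration shows that the length range is nonempty, and a nonempty interval determines
  its end points; this is how the given \<open>l\<close> and \<open>u\<close> become the actual bounds.\<close>
lemma length_range_bounds:
  assumes "length_range d = {l..u}" and "x \<in> configs d"
  shows "l \<le> dist (x (length d)) (x 0)" and "dist (x (length d)) (x 0) \<le> u"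
proof -
  have "dist (x (length d)) (x 0) \<in> length_range d"
    using min_length_le[OF assms(2)] le_max_length[OF assms(2)] by (simp add: length_range_def)
  then show "l \<le> dist (x (length d)) (x 0)" "dist (x (length d)) (x 0) \<le> u"
    using assms(1) by auto
qed

section \<open>Two-edge linkages with prescribed end points\<close>

definition rot90 :: "plane \<Rightarrow> plane" where
  "rot90 v = vector [- (v $ 2), v $ 1]"

lemma rot90_nth [simp]: "rot90 v $ 1 = - (v $ 2)" "rot90 v $ 2 = v $ 1"
  by (simp_all add: rot90_def vector_2)

lemma norm_plane_sq: "(norm (v :: plane))\<^sup>2 = (v $ 1)\<^sup>2 + (v $ 2)\<^sup>2"
  unfolding power2_norm_eq_inner by (simp add: inner_vec_def sum_2 power2_eq_square)

lemma inner_plane: "(v :: plane) \<bullet> w = v $ 1 * w $ 1 + v $ 2 * w $ 2"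
  by (simp add: inner_vec_def sum_2)

lemma continuous_on_rot90: "continuous_on S rot90"
proof -
  have eq: "rot90 = (\<lambda>v. - (v $ 2) *\<^sub>R axis 1 1 + (v $ 1) *\<^sub>R axis 2 1)"
    by (auto simp: fun_eq_iff vec_eq_iff forall_2 axis_def)
  show ?thesis unfolding eq by (intro continuous_intros)
qed

text \<open>The group \<open>SO(2)\<close> is commutative: from orthogonality and determinant 1, a rotation matrix has
  equal diagonal entries and opposite off-diagonal ones. This is why rotations preserve
  the side of the base line on which an apex lies; reflections do not.\<close>
lemma rotation_matrix_rot90:
  assumes "rotation_matrix A"
  shows "A *v rot90 v = rot90 (A *v v)"
proof -
  have "transpose A ** A = mat 1" and det: "A$1$1 * A$2$2 - A$1$2 * A$2$1 = 1"
    using assms by (auto simp: rotation_matrix_def orthogonal_matrix det_2)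
  then have e: "(transpose A ** A) $ i $ j = (mat 1 :: real^2^2) $ i $ j" for i j by simp
  have o: "A$1$1 * A$1$1 + A$2$1 * A$2$1 = 1" "A$1$2 * A$1$2 + A$2$2 * A$2$2 = 1"
     "A$1$1 * A$1$2 + A$2$1 * A$2$2 = 0"
    using e[of 1 1] e[of 2 2] e[of 1 2]
    by (simp_all add: matrix_matrix_mult_def transpose_def mat_def sum_2)
  have "A$2$2 = A$1$1" using o det by algebra
  moreover have "A$1$2 = - A$2$1" using o det by algebra
  ultimately show ?thesis
    by (simp add: vec_eq_iff forall_2 matrix_vector_mult_def sum_2 algebra_simps)
qed

lemma rotation_matrix_norm:
  fixes A :: "real^'n^'n"
  assumes "rotation_matrix A"
  shows "norm (A *v v) = norm v"
proof -
  have "orthogonal_transformation ((*v) A)"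
    using assms by (simp add: orthogonal_transformation_matrix rotation_matrix_def)
  then show ?thesis by (rule orthogonal_transformation_norm)
qed

text \<open>For an apex \<open>m\<close> over the base from \<open>0\<close> to \<open>t\<close> with \<open>norm m = a\<close> and \<open>dist m t = b\<close>, the law of
  cosines determines \<open>m \<bullet> t\<close>. By Pythagoras, \<open>m \<bullet> rot90 t\<close> is then known up to sign; its absolute
  value is twice the area of the triangle.\<close>
definition hinge_proj :: "real \<Rightarrow> real \<Rightarrow> plane \<Rightarrow> real" where
  "hinge_proj a b t = (a\<^sup>2 - b\<^sup>2 + (norm t)\<^sup>2) / 2"

definition hinge_area :: "real \<Rightarrow> real \<Rightarrow> plane \<Rightarrow> real" where
  "hinge_area a b t = sqrt (a\<^sup>2 * (norm t)\<^sup>2 - (hinge_proj a b t)\<^sup>2)"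

definition side :: "bool \<Rightarrow> real" where
  "side s = (if s then 1 else - 1)"

definition hinge :: "real \<Rightarrow> real \<Rightarrow> bool \<Rightarrow> plane \<Rightarrow> plane" where
  "hinge a b s t = (hinge_proj a b t / (norm t)\<^sup>2) *\<^sub>R t +
     (side s * hinge_area a b t / (norm t)\<^sup>2) *\<^sub>R rot90 t"

text \<open>Heron's formula: both sides are 16 times the squared area of the triangle. The
  factorisation shows when the triangle exists and when it degenerates.\<close>
lemma heron_formula:
  "4 * (a\<^sup>2 * (norm t)\<^sup>2 - (hinge_proj a b t)\<^sup>2) =
     ((a + b)\<^sup>2 - (norm t)\<^sup>2) * ((norm t)\<^sup>2 - (a - b)\<^sup>2)"
  unfolding hinge_proj_def power2_eq_square by (simp add: field_simps)

lemma hinge_proj_sq_le: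
  assumes "\<bar>a - b\<bar> \<le> norm t" "norm t \<le> a + b"
  shows "(hinge_proj a b t)\<^sup>2 \<le> a\<^sup>2 * (norm t)\<^sup>2"
proof -
  have "(a - b)\<^sup>2 \<le> (norm t)\<^sup>2"
    using assms(1) power_mono[of "\<bar>a - b\<bar>" "norm t" 2] by simp
  moreover have "(norm t)\<^sup>2 \<le> (a + b)\<^sup>2"
    using assms(2) by (simp add: power_mono)
  ultimately have "0 \<le> ((a + b)\<^sup>2 - (norm t)\<^sup>2) * ((norm t)\<^sup>2 - (a - b)\<^sup>2)" by simp
  then show ?thesis unfolding heron_formula[of a t b, symmetric] by simp
qed

lemma hinge_area_eq_0_iff:
  assumes "norm t < a + b"
  shows "hinge_area a b t = 0 \<longleftrightarrow> norm t = \<bar>a - b\<bar>"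
proof -
  have "(norm t)\<^sup>2 < (a + b)\<^sup>2" using assms by (simp add: power_strict_mono)
  then have "hinge_area a b t = 0 \<longleftrightarrow> (norm t)\<^sup>2 = (a - b)\<^sup>2"
    using heron_formula[of a t b] by (auto simp: hinge_area_def)
  also have "\<dots> \<longleftrightarrow> norm t = \<bar>a - b\<bar>"
    using power2_eq_iff_nonneg[of "norm t" "\<bar>a - b\<bar>"] by simp
  finally show ?thesis .
qed

lemma plane_decomposition:
  assumes "t \<noteq> 0"
  shows "m = ((m \<bullet> t) / (norm t)\<^sup>2) *\<^sub>R t + ((m \<bullet> rot90 t) / (norm t)\<^sup>2) *\<^sub>R rot90 t"
proof -
  have "(norm t)\<^sup>2 \<noteq> 0" using assms by simp
  then have *: "(t$1)\<^sup>2 + (t$2)\<^sup>2 \<noteq> 0" by (simp add: norm_plane_sq)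
  have 1: "m$1 * ((t$1)\<^sup>2 + (t$2)\<^sup>2) = (m \<bullet> t) * t$1 - (m \<bullet> rot90 t) * t$2"
    and 2: "m$2 * ((t$1)\<^sup>2 + (t$2)\<^sup>2) = (m \<bullet> t) * t$2 + (m \<bullet> rot90 t) * t$1"
    by (simp_all add: inner_plane algebra_simps power2_eq_square)
  have "m$1 = (m \<bullet> t) / ((t$1)\<^sup>2 + (t$2)\<^sup>2) * t$1 - (m \<bullet> rot90 t) / ((t$1)\<^sup>2 + (t$2)\<^sup>2) * t$2"
    using 1 * by (simp add: eq_divide_eq diff_divide_distrib [symmetric])
  moreover have "m$2 = (m \<bullet> t) / ((t$1)\<^sup>2 + (t$2)\<^sup>2) * t$2 + (m \<bullet> rot90 t) / ((t$1)\<^sup>2 + (t$2)\<^sup>2) * t$1"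
    using 2 * by (simp add: eq_divide_eq add_divide_distrib [symmetric])
  ultimately show ?thesis by (simp add: vec_eq_iff forall_2 norm_plane_sq)
qed

lemma inner_sq_plus_inner_rot90_sq:
  "(m \<bullet> t)\<^sup>2 + (m \<bullet> rot90 t)\<^sup>2 = (norm m)\<^sup>2 * (norm t)\<^sup>2"
  unfolding norm_plane_sq inner_plane rot90_nth by algebra

lemma two_edge_iff_proj:
  assumes "a \<ge> 0" "b \<ge> 0"
  shows "norm m = a \<and> dist m t = b \<longleftrightarrow> norm m = a \<and> m \<bullet> t = hinge_proj a b t"
proof -
  have "dist m t = b \<longleftrightarrow> (norm (m - t))\<^sup>2 = b\<^sup>2"
    using assms by (simp add: dist_norm power2_eq_iff_nonneg)
  also have "(norm (m - t))\<^sup>2 = (norm m)\<^sup>2 - 2 * (m \<bullet> t) + (norm t)\<^sup>2"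
    by (simp add: power2_norm_eq_inner inner_diff algebra_simps inner_commute)
  finally show ?thesis by (auto simp: hinge_proj_def)
qed

lemma side_sq [simp]: "(side s)\<^sup>2 = 1" "side s * side s = 1"
  by (simp_all add: side_def)

lemma hinge_inner_rot90:
  assumes "t \<noteq> 0"
  shows "hinge a b s t \<bullet> rot90 t = side s * hinge_area a b t"
proof -
  have "t \<bullet> rot90 t = 0" "rot90 t \<bullet> rot90 t = (norm t)\<^sup>2"
    by (simp_all add: inner_plane norm_plane_sq power2_eq_square[of "_ $ _"])
  then show ?thesis using assms by (simp add: hinge_def inner_add_left)
qed

lemma hinge_inner:
  assumes "t \<noteq> 0"
  shows "hinge a b s t \<bullet> t = hinge_proj a b t"
proof -
  have "rot90 t \<bullet> t = 0" "t \<bullet> t = (norm t)\<^sup>2"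
    by (simp_all add: inner_plane norm_plane_sq power2_eq_square[of "_ $ _"])
  then show ?thesis using assms by (simp add: hinge_def inner_add_left)
qed

lemma hinge_solves:
  assumes "a \<ge> 0" "b \<ge> 0" "t \<noteq> 0" "\<bar>a - b\<bar> \<le> norm t" "norm t \<le> a + b"
  shows "norm (hinge a b s t) = a" and "dist (hinge a b s t) t = b"
proof -
  have "(hinge_proj a b t)\<^sup>2 + (hinge_area a b t)\<^sup>2 = a\<^sup>2 * (norm t)\<^sup>2"
    using hinge_proj_sq_le[OF assms(4,5)] by (simp add: hinge_area_def)
  then have "(norm (hinge a b s t))\<^sup>2 * (norm t)\<^sup>2 = a\<^sup>2 * (norm t)\<^sup>2"
    using inner_sq_plus_inner_rot90_sq[of "hinge a b s t" t] assms(3)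
    by (simp add: hinge_inner hinge_inner_rot90 power_mult_distrib)
  then have "(norm (hinge a b s t))\<^sup>2 = a\<^sup>2" using assms(3) by simp
  then have n: "norm (hinge a b s t) = a" using assms(1) by (simp add: power2_eq_iff_nonneg)
  then show "norm (hinge a b s t) = a" .
  show "dist (hinge a b s t) t = b"
    using two_edge_iff_proj[OF assms(1,2)] n hinge_inner[OF assms(3)] by blast
qed

lemma hinge_unique:
  assumes "t \<noteq> 0" "norm m = a" "dist m t = b" "0 \<le> side s * (m \<bullet> rot90 t)"
  shows "hinge a b s t = m"
proof -
  have "a \<ge> 0" "b \<ge> 0" using assms(2,3) by auto
  then have p: "m \<bullet> t = hinge_proj a b t" using two_edge_iff_proj assms(2,3) by blast
  have "hinge_area a b t = sqrt ((m \<bullet> rot90 t)\<^sup>2)"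
    using inner_sq_plus_inner_rot90_sq[of m t] unfolding hinge_area_def p[symmetric] assms(2)
    by (metis add_diff_cancel_left')
  then have "side s * hinge_area a b t = m \<bullet> rot90 t"
    using assms(4) by (auto simp: side_def split: if_splits)
  then show ?thesis
    using plane_decomposition[OF assms(1), of m] by (simp add: hinge_def p)
qed

text \<open>The coefficients in the definition of the apex depend on \<open>norm t\<close> only.\<close>
lemma hinge_rotation:
  assumes "rotation_matrix A"
  shows "hinge a b s (A *v t) = A *v hinge a b s t"
  using assms
  by (simp add: hinge_def hinge_proj_def hinge_area_def rotation_matrix_norm rotation_matrix_rot90
      matrix_vector_right_distrib matrix_vector_mult_scaleR)

text \<open>The two apexes differ by the reflection in the base line, so they agree exactly if the
  triangle is degenerate.\<close>
lemma hinge_eq_iff: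
  assumes "t \<noteq> 0" "norm t < a + b"
  shows "hinge a b s t = hinge a b s' t \<longleftrightarrow> s = s' \<or> norm t = \<bar>a - b\<bar>"
proof
  assume "hinge a b s t = hinge a b s' t"
  then have "side s * hinge_area a b t = side s' * hinge_area a b t"
    using hinge_inner_rot90[OF assms(1)] by metis
  then show "s = s' \<or> norm t = \<bar>a - b\<bar>"
    using hinge_area_eq_0_iff[OF assms(2)] by (auto simp: side_def split: if_splits)
next
  assume "s = s' \<or> norm t = \<bar>a - b\<bar>"
  then show "hinge a b s t = hinge a b s' t"
    using hinge_area_eq_0_iff[OF assms(2)] by (auto simp: hinge_def)
qed

lemma continuous_on_hinge: "continuous_on (- {0}) (hinge a b s)"
  unfolding hinge_def hinge_proj_def hinge_area_def
  by (intro continuous_intros continuous_on_rot90) auto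

section \<open>Joint configurations\<close>

lemma continuous_map_joint_vertex:
  assumes "j < length F" "i \<le> length (F ! j)"
  shows "continuous_map (joint_config_space F) euclidean (\<lambda>x. x j i)"
proof -
  have "continuous_map (joint_config_space F) (product_topology (\<lambda>_. euclidean) {..length (F ! j)}) (\<lambda>x. x j)"
    unfolding joint_config_space_def using assms(1)
    by (intro continuous_map_from_subtopology continuous_map_product_projection
        [where X = "\<lambda>j. product_topology (\<lambda>_. euclidean) {..length (F ! j)}"]) simp
  moreover have "continuous_map (product_topology (\<lambda>_. euclidean) {..length (F ! j)}) euclidean (\<lambda>x. x i :: plane)"
    using assms(2) continuous_map_product_projection[of i "{..length (F ! j)}" "\<lambda>_. euclidean"] by simp
  ultimately have "continuous_map (joint_config_space F) euclidean ((\<lambda>x. x i) \<circ> (\<lambda>x. x j))"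
    by (rule continuous_map_compose)
  then show ?thesis by (simp add: o_def)
qed

definition terminal :: "real list list \<Rightarrow> (nat \<Rightarrow> nat \<Rightarrow> plane) \<Rightarrow> plane" where
  "terminal F x = x 0 (length (F ! 0))"

text \<open>Referring all terminal vertices to a single one replaces the pairwise comparison in the
  definition. For the empty list the value of \<open>terminal\<close> is arbitrary, and no vertex is compared
  to it.\<close>
lemma joint_configs_iff:
  "x \<in> joint_configs F \<longleftrightarrow> x \<in> extensional {..<length F} \<and>
     (\<forall>j < length F. x j \<in> configs (F ! j) \<and> x j 0 = 0 \<and> x j (length (F ! j)) = terminal F x)"
proof -
  have "(\<forall>j < length F. \<forall>k < length F. x j (length (F ! j)) = x k (length (F ! k))) \<longleftrightarrow>
      (\<forall>j < length F. x j (length (F ! j)) = terminal F x)"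
    unfolding terminal_def by (cases "0 < length F") (metis, simp)
  then show ?thesis
    by (auto simp: joint_configs_def PiE_iff)
qed

lemma continuous_map_into_joint_config_space:
  assumes "f ` topspace X \<subseteq> joint_configs F"
    and "\<And>j i. \<lbrakk>j < length F; i \<le> length (F ! j)\<rbrakk> \<Longrightarrow> continuous_map X euclidean (\<lambda>x. f x j i)"
  shows "continuous_map X (joint_config_space F) f"
proof -
  have "f x \<in> extensional {..<length F}" "f x j \<in> extensional {..length (F ! j)}"
    if "x \<in> topspace X" "j < length F" for x j
    using assms(1) that by (auto simp: joint_configs_iff configs_def PiE_iff image_subset_iff)
  moreover have "f x \<in> extensional {..<length F}" if "x \<in> topspace X" for x
    using assms(1) that by (auto simp: joint_configs_iff image_subset_iff)
  ultimately show ?thesis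
    using assms unfolding joint_config_space_def
    by (auto simp: continuous_map_in_subtopology continuous_map_componentwise)
qed

definition detach :: "real list list \<Rightarrow> (nat \<Rightarrow> nat \<Rightarrow> plane) \<Rightarrow> nat \<Rightarrow> nat \<Rightarrow> plane" where
  "detach F y = restrict y {..<length F}"

definition attach ::
  "real \<Rightarrow> real \<Rightarrow> bool \<Rightarrow> real list list \<Rightarrow> (nat \<Rightarrow> nat \<Rightarrow> plane) \<Rightarrow> nat \<Rightarrow> nat \<Rightarrow> plane" where
  "attach a b s F x = x(length F :=
     (\<lambda>i\<in>{..2}. if i = 0 then 0 else if i = 1 then hinge a b s (terminal F x) else terminal F x))"

lemma configs_two_edges:
  "y \<in> configs [a, b] \<longleftrightarrow> y \<in> extensional {..2} \<and> dist (y 0) (y 1) = a \<and> dist (y 1) (y 2) = b"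
  by (auto simp: configs_def PiE_iff numeral_2_eq_2 less_Suc_eq)

lemma joint_configs_snoc:
  assumes "F \<noteq> []"
  shows "y \<in> joint_configs (F @ [d]) \<longleftrightarrow>
     y \<in> extensional {..length F} \<and> detach F y \<in> joint_configs F \<and> y (length F) \<in> configs d \<and>
     y (length F) 0 = 0 \<and> y (length F) (length d) = terminal F y"
proof -
  have ext: "detach F y \<in> extensional {..<length F}" by (simp add: detach_def)
  have t: "terminal (F @ [d]) y = terminal F y" "terminal F (detach F y) = terminal F y"
    using assms by (simp_all add: terminal_def detach_def nth_append)
  show ?thesis
    unfolding joint_configs_iff t using ext
    by (auto simp: nth_append less_Suc_eq detach_def lessThan_Suc_atMost)
qed

lemma terminal_detach [simp]: "F \<noteq> [] \<Longrightarrow> terminal F (detach F y) = terminal F y"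
  by (simp add: terminal_def detach_def)

lemma terminal_attach [simp]: "F \<noteq> [] \<Longrightarrow> terminal F (attach a b s F x) = terminal F x"
  by (simp add: terminal_def attach_def)

lemma detach_attach [simp]:
  assumes "x \<in> joint_configs F"
  shows "detach F (attach a b s F x) = x"
  using assms by (auto simp: fun_eq_iff detach_def attach_def joint_configs_iff extensional_def)

lemma attach_last [simp]:
  "attach a b s F x (length F) 0 = 0"
  "attach a b s F x (length F) (Suc 0) = hinge a b s (terminal F x)"
  "attach a b s F x (length F) 2 = terminal F x"
  by (simp_all add: attach_def)

lemma attach_in_joint_configs:
  assumes F: "F \<noteq> []" and x: "x \<in> joint_configs F"
    and ab: "a \<ge> 0" "b \<ge> 0" and t: "terminal F x \<noteq> 0"
    and bd: "\<bar>a - b\<bar> \<le> norm (terminal F x)" "norm (terminal F x) \<le> a + b"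
  shows "attach a b s F x \<in> joint_configs (F @ [[a, b]])"
proof -
  have "attach a b s F x \<in> extensional {..length F}"
    using x by (auto simp: attach_def extensional_def joint_configs_iff)
  moreover have "attach a b s F x (length F) \<in> configs [a, b]"
    using hinge_solves[OF ab t bd, of s] by (simp add: configs_two_edges) (simp add: attach_def)
  ultimately show ?thesis
    using F x attach_last(3)[of a b s F x, unfolded numeral_2_eq_2] by (simp add: joint_configs_snoc)
qed

text \<open>The orientation of the triangle at the new linkage tells which of the two completions was
  used. When it vanishes, both values of \<open>s\<close> satisfy the assumption.\<close>
lemma attach_detach:
  assumes F: "F \<noteq> []" and y: "y \<in> joint_configs (F @ [[a, b]])" and t: "terminal F y \<noteq> 0"
    and s: "0 \<le> side s * (y (length F) 1 \<bullet> rot90 (terminal F y))"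
  shows "attach a b s F (detach F y) = y"
proof -
  have y': "y \<in> extensional {..length F}" "y (length F) \<in> extensional {..2}"
    "dist (y (length F) 0) (y (length F) 1) = a" "dist (y (length F) 1) (y (length F) 2) = b"
    "y (length F) 0 = 0" "y (length F) 2 = terminal F y"
    using y F by (auto simp: joint_configs_snoc configs_two_edges numeral_2_eq_2)
  have h: "hinge a b s (terminal F y) = y (length F) 1"
    using y' s t by (intro hinge_unique) auto
  have "attach a b s F (detach F y) (length F) i = y (length F) i" for i
  proof (cases "i \<le> 2")
    case True
    then consider "i = 0" | "i = 1" | "i = 2" by linarith
    then show ?thesis using F y' h by cases simp_all
  next
    case False
    then show ?thesis using y'(2) by (simp add: attach_def extensional_def)
  qed
  moreover have "attach a b s F (detach F y) j = y j" if "j \<noteq> length F" for j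
    using that y'(1) by (auto simp: attach_def detach_def extensional_def)
  ultimately have "attach a b s F (detach F y) j i = y j i" for j i
    by (cases "j = length F") simp_all
  then show ?thesis by (simp add: fun_eq_iff)
qed

text \<open>A rotation relating two completed configurations relates the original ones, and it takes the
  apex on side \<open>s\<close> to the apex on side \<open>s\<close> over the rotated base. So the sides agree unless
  both apexes coincide. The converse holds for the same reason.\<close>
lemma SO2_rel_attach_iff:
  assumes F: "F \<noteq> []" and x: "x \<in> joint_configs F" and y: "y \<in> joint_configs F"
    and gx: "attach a b s F x \<in> joint_configs (F @ [[a, b]])"
    and gy: "attach a b s' F y \<in> joint_configs (F @ [[a, b]])"
    and t: "terminal F x \<noteq> 0" "norm (terminal F x) < a + b"
  shows "(attach a b s F x, attach a b s' F y) \<in> SO2_rel (F @ [[a, b]]) \<longleftrightarrow>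
     (x, y) \<in> SO2_rel F \<and> (s = s' \<or> norm (terminal F x) = \<bar>a - b\<bar>)"
proof -
  have two: "(\<forall>i\<le>2. P i) \<longleftrightarrow> P 0 \<and> P (Suc 0) \<and> P 2" for P :: "nat \<Rightarrow> bool"
    by (auto simp: numeral_2_eq_2 le_Suc_eq)
  have rot: "(\<forall>j < length (F @ [[a, b]]). \<forall>i \<le> length ((F @ [[a, b]]) ! j).
        attach a b s' F y j i = A *v attach a b s F x j i) \<longleftrightarrow>
      (\<forall>j < length F. \<forall>i \<le> length (F ! j). y j i = A *v x j i) \<and>
      (s = s' \<or> norm (terminal F x) = \<bar>a - b\<bar>)" (is "?L \<longleftrightarrow> ?R \<and> _")
    if A: "rotation_matrix A" for A
  proof -
    have "?L \<longleftrightarrow> ?R \<and> (\<forall>i\<le>2. attach a b s' F y (length F) i = A *v attach a b s F x (length F) i)"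
      by (auto simp: less_Suc_eq nth_append attach_def numeral_2_eq_2)
    also have "\<dots> \<longleftrightarrow> ?R \<and> hinge a b s' (terminal F y) = A *v hinge a b s (terminal F x) \<and>
        terminal F y = A *v terminal F x"
      by (simp add: two)
    also have "\<dots> \<longleftrightarrow> ?R \<and> hinge a b s' (A *v terminal F x) = hinge a b s (A *v terminal F x)"
      using F by (auto simp: terminal_def hinge_rotation[OF A])
    also have "\<dots> \<longleftrightarrow> ?R \<and> (s' = s \<or> norm (terminal F x) = \<bar>a - b\<bar>)"
    proof -
      have "norm (A *v terminal F x) = norm (terminal F x)" by (rule rotation_matrix_norm[OF A])
      then show ?thesis
        using hinge_eq_iff[of "A *v terminal F x" a b s' s] t by (metis norm_eq_zero)
    qed
    finally show ?thesis by blast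
  qed
  show ?thesis
    unfolding SO2_rel_def mem_Collect_eq prod.case using x y gx gy rot by blast
qed

section \<open>Attaching a two-edge linkage doubles the moduli space\<close>

text \<open>The assumption \<open>a \<noteq> b\<close> together with the lower bound keeps the terminal vertex away from the
  origin, where the apexes would form a whole circle.\<close>
lemma moduli_space_attach_two_edges:
  assumes F: "F \<noteq> []" and ab: "a \<ge> 0" "b \<ge> 0" "a \<noteq> b"
    and lower: "\<And>x. x \<in> joint_configs F \<Longrightarrow> \<bar>a - b\<bar> \<le> norm (terminal F x)"
    and upper: "\<And>x. x \<in> joint_configs F \<Longrightarrow> norm (terminal F x) < a + b"
  shows "moduli_space (F @ [[a, b]]) homeomorphic_space
     double_along (moduli_space F)
       {SO2_rel F `` {x} | x. x \<in> joint_configs F \<and> norm (terminal F x) = \<bar>a - b\<bar>}"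
    (is "_ homeomorphic_space double_along _ ?A")
proof -
  let ?F = "F @ [[a, b]]"
  let ?X = "joint_config_space F" and ?Y = "joint_config_space ?F"
  let ?S = "sum_topology (\<lambda>_::bool. ?X) UNIV"
  note [simp] = topspace_joint_config_space
  have nz: "terminal F x \<noteq> 0" if "x \<in> joint_configs F" for x
    using lower[OF that] ab(3) by auto
  have det: "detach F y \<in> joint_configs F" if "y \<in> joint_configs ?F" for y
    using that F by (simp add: joint_configs_snoc)
  have nzY: "terminal F y \<noteq> 0" if "y \<in> joint_configs ?F" for y
    using nz[OF det[OF that]] F by simp
  have att: "attach a b s F x \<in> joint_configs ?F" if "x \<in> joint_configs F" for s x
    using attach_in_joint_configs[OF F that ab(1,2) nz[OF that] lower[OF that]] upper[OF that] by simp
  have cterm: "continuous_map ?X euclidean (terminal F)"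
    unfolding terminal_def using F by (intro continuous_map_joint_vertex) auto
  have "continuous_map ?X (top_of_set (- {0})) (terminal F)"
    using cterm nz by (auto simp: continuous_map_in_subtopology)
  then have chinge: "continuous_map ?X euclidean (\<lambda>x. hinge a b s (terminal F x))" for s
    using continuous_map_compose[of ?X "top_of_set (- {0})" "terminal F" euclidean "hinge a b s"]
      continuous_on_hinge by (simp add: o_def)
  have cdet: "continuous_map ?Y ?X (detach F)"
  proof (rule continuous_map_into_joint_config_space)
    fix j i assume "j < length F" "i \<le> length (F ! j)"
    then show "continuous_map ?Y euclidean (\<lambda>y. detach F y j i)"
      using continuous_map_joint_vertex[of j ?F i] by (simp add: detach_def nth_append)
  qed (use det in auto)
  have catt: "continuous_map ?X ?Y (attach a b s F)" for s
  proof (rule continuous_map_into_joint_config_space)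
    fix j i assume j: "j < length ?F" and i: "i \<le> length (?F ! j)"
    show "continuous_map ?X euclidean (\<lambda>x. attach a b s F x j i)"
    proof (cases "j = length F")
      case True
      then have "i \<le> 2" using i by simp
      then consider "i = 0" | "i = Suc 0" | "i = 2" by linarith
      then show ?thesis using True cterm chinge by cases simp_all
    next
      case False
      then show ?thesis
        using i j continuous_map_joint_vertex[of j F i] by (simp add: attach_def nth_append)
    qed
  qed (use att in auto)
  define orient where "orient y = y (length F) 1 \<bullet> rot90 (terminal F y)" for y :: "nat \<Rightarrow> nat \<Rightarrow> plane"
  define C where "C s = {y \<in> topspace ?Y. 0 \<le> side s * orient y}" for s
  have corient: "continuous_map ?Y euclidean (\<lambda>y. side s * orient y)" for s
  proof -
    have 1: "continuous_map ?Y euclidean (\<lambda>y. y (length F) 1)"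
      by (intro continuous_map_joint_vertex) auto
    have 2: "continuous_map ?Y euclidean (\<lambda>y. terminal F y)"
      using continuous_map_compose[OF cdet cterm] F by (simp add: o_def)
    have 3: "continuous_map ?Y euclidean (\<lambda>y. rot90 (terminal F y))"
      using continuous_map_compose[OF 2, of euclidean rot90] continuous_on_rot90 by (simp add: o_def)
    have nth: "continuous_map ?Y euclidean (\<lambda>y. u y $ k)"
      if "continuous_map ?Y euclidean u" for u :: "_ \<Rightarrow> plane" and k
    proof -
      have "continuous_on UNIV (\<lambda>v :: plane. v $ k)" by (intro continuous_intros)
      then show ?thesis
        using continuous_map_compose[OF that, of euclidean "\<lambda>v. v $ k"] by (simp add: o_def)
    qed
    show ?thesis
      unfolding orient_def inner_plane
      by (intro continuous_map_real_mult continuous_map_add nth 1 3) simp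
  qed
  \<comment> \<open>The closed pieces \<open>C True\<close> and \<open>C False\<close> meet in the configurations with degenerate triangle.\<close>
  have q1: "quotient_map ?S ?Y (\<lambda>(s, x). attach a b s F x)"
  proof (rule quotient_map_from_sections[where r = "detach F" and C = C])
    show "closedin ?Y (C s)" for s
      using closedin_continuous_map_preimage[OF corient, of "{0..}" s] by (simp add: C_def)
    have "y \<in> C (0 \<le> orient y)" if "y \<in> topspace ?Y" for y
      using that by (simp add: C_def side_def)
    then show "(\<Union>s\<in>UNIV. C s) = topspace ?Y" by (auto simp: C_def)
    fix s x assume "x \<in> topspace ?X"
    then have x: "x \<in> joint_configs F" by simp
    have "0 \<le> hinge_area a b (terminal F x)"
      using hinge_proj_sq_le[OF lower[OF x]] upper[OF x] by (simp add: hinge_area_def)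
    then have "0 \<le> side s * orient (attach a b s F x)"
      using F hinge_inner_rot90[OF nz[OF x], of a b s] by (simp add: orient_def flip: mult.assoc)
    then show "attach a b s F x \<in> C s" using att[OF x] by (simp add: C_def)
    show "detach F (attach a b s F x) = x" using x by simp
  next
    fix s y assume "y \<in> C s"
    then show "attach a b s F (detach F y) = y"
      using attach_detach[OF F, of y a b s] nzY by (simp add: C_def orient_def)
  qed (use catt cdet in auto)
  have Q1: "quotient_map ?S (moduli_space ?F) ((\<lambda>y. SO2_rel ?F `` {y}) \<circ> (\<lambda>(s, x). attach a b s F x))"
    unfolding moduli_space_def by (rule quotient_map_compose[OF q1 quotient_map_quotient_topology])
  have q2: "quotient_map ?S (sum_topology (\<lambda>_::bool. moduli_space F) UNIV) (\<lambda>(s, x). (s, SO2_rel F `` {x}))"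
    unfolding moduli_space_def by (rule quotient_map_sum_topology) (rule quotient_map_quotient_topology)
  have Q2: "quotient_map ?S (double_along (moduli_space F) ?A)
      ((\<lambda>p. double_rel (moduli_space F) ?A `` {p}) \<circ> (\<lambda>(s, x). (s, SO2_rel F `` {x})))"
    unfolding double_along_def by (rule quotient_map_compose[OF q2 quotient_map_quotient_topology])
  \<comment> \<open>The length of the terminal vector is invariant under rotation, so it is determined by the class.\<close>
  have locus: "SO2_rel F `` {x} \<in> ?A \<longleftrightarrow> norm (terminal F x) = \<bar>a - b\<bar>" if x: "x \<in> joint_configs F" for x
  proof
    assume "SO2_rel F `` {x} \<in> ?A"
    then obtain x' where x': "x' \<in> joint_configs F" "norm (terminal F x') = \<bar>a - b\<bar>"
      "SO2_rel F `` {x} = SO2_rel F `` {x'}" by blast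
    then have "(x, x') \<in> SO2_rel F"
      using eq_equiv_class_iff[OF equiv_SO2_rel x x'(1)] by simp
    then obtain A :: "real^2^2" where "rotation_matrix A" "terminal F x' = A *v terminal F x"
      using F by (auto simp: SO2_rel_def terminal_def)
    then show "norm (terminal F x) = \<bar>a - b\<bar>" using x'(2) rotation_matrix_norm by metis
  qed (use x in blast)
  show ?thesis
  proof (rule quotient_maps_with_same_fibres[OF Q1 Q2])
    fix p p' assume "p \<in> topspace ?S" "p' \<in> topspace ?S"
    then obtain s x s' y where p: "p = (s, x)" "p' = (s', y)"
      and x: "x \<in> joint_configs F" and y: "y \<in> joint_configs F"
      by auto
    have cls: "SO2_rel F `` {z} \<in> topspace (moduli_space F)" if "z \<in> joint_configs F" for z
      using that by (simp add: moduli_space_def quotientI)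
    have "((\<lambda>y. SO2_rel ?F `` {y}) \<circ> (\<lambda>(s, x). attach a b s F x)) p =
          ((\<lambda>y. SO2_rel ?F `` {y}) \<circ> (\<lambda>(s, x). attach a b s F x)) p' \<longleftrightarrow>
        (attach a b s F x, attach a b s' F y) \<in> SO2_rel ?F"
      using eq_equiv_class_iff[OF equiv_SO2_rel att[OF x] att[OF y]] by (simp add: p)
    also have "\<dots> \<longleftrightarrow> (x, y) \<in> SO2_rel F \<and> (s = s' \<or> norm (terminal F x) = \<bar>a - b\<bar>)"
      using SO2_rel_attach_iff[OF F x y att[OF x] att[OF y] nz[OF x] upper[OF x]] .
    also have "\<dots> \<longleftrightarrow> ((s, SO2_rel F `` {x}), (s', SO2_rel F `` {y})) \<in> double_rel (moduli_space F) ?A"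
      using cls[OF x] cls[OF y] locus[OF x] eq_equiv_class_iff[OF equiv_SO2_rel x y]
      by (simp add: double_rel_def)
    also have "\<dots> \<longleftrightarrow> ((\<lambda>p. double_rel (moduli_space F) ?A `` {p}) \<circ> (\<lambda>(s, x). (s, SO2_rel F `` {x}))) p =
        ((\<lambda>p. double_rel (moduli_space F) ?A `` {p}) \<circ> (\<lambda>(s, x). (s, SO2_rel F `` {x}))) p'"
      using cls[OF x] cls[OF y]
        eq_equiv_class_iff[OF equiv_double_rel,
          of "(s, SO2_rel F `` {x})" "moduli_space F" "(s', SO2_rel F `` {y})" ?A]
      by (simp add: p)
    finally show "((\<lambda>y. SO2_rel ?F `` {y}) \<circ> (\<lambda>(s, x). attach a b s F x)) p =
          ((\<lambda>y. SO2_rel ?F `` {y}) \<circ> (\<lambda>(s, x). attach a b s F x)) p' \<longleftrightarrow>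
        ((\<lambda>p. double_rel (moduli_space F) ?A `` {p}) \<circ> (\<lambda>(s, x). (s, SO2_rel F `` {x}))) p =
        ((\<lambda>p. double_rel (moduli_space F) ?A `` {p}) \<circ> (\<lambda>(s, x). (s, SO2_rel F `` {x}))) p'" .
  qed
qed

theorem proposition5p10:
  fixes F1 F2 F3 :: "real list" and a b l11 l12 l21 l22 :: real
  assumes "free_linkage F1" and "free_linkage F2" and "free_linkage F3"
    and "length_range F1 = {l11..l12}" and "length_range F2 = {l21..l22}"
    and "F3 = [a, b]"
    and "\<bar>a - b\<bar> = max l11 l21" and "max l11 l21 > 0"
    and "a + b > min l12 l22"
  shows "moduli_space [F1, F2, F3] homeomorphic_space
           double_along (moduli_space [F1, F2]) (zero_angle_locus F1 F2 a b)"
proof -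
  have ab: "a > 0" "b > 0" "a \<noteq> b"
    using assms(3,6,7,8) by (auto simp: free_linkage_def less_Suc_eq)
  have bounds: "\<bar>a - b\<bar> \<le> norm (terminal [F1, F2] x)" "norm (terminal [F1, F2] x) < a + b"
    if "x \<in> joint_configs [F1, F2]" for x
  proof -
    have x: "x 0 \<in> configs F1" "x 1 \<in> configs F2" "x 0 0 = 0" "x 1 0 = 0"
      "x 0 (length F1) = terminal [F1, F2] x" "x 1 (length F2) = terminal [F1, F2] x"
      using that by (auto simp: joint_configs_iff less_Suc_eq)
    show "\<bar>a - b\<bar> \<le> norm (terminal [F1, F2] x)" "norm (terminal [F1, F2] x) < a + b"
      using length_range_bounds[OF assms(4) x(1)] length_range_bounds[OF assms(5) x(2)] x assms(7,9)
      by auto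
  qed
  have double: "moduli_space ([F1, F2] @ [[a, b]]) homeomorphic_space
     double_along (moduli_space [F1, F2])
       {SO2_rel [F1, F2] `` {x} | x. x \<in> joint_configs [F1, F2] \<and> norm (terminal [F1, F2] x) = \<bar>a - b\<bar>}"
    using ab bounds by (intro moduli_space_attach_two_edges) auto
  have "dist (x 0 0) (x 0 (length F1)) = norm (terminal [F1, F2] x)"
    if "x \<in> joint_configs [F1, F2]" for x
    using that by (auto simp: joint_configs_iff)
  then have "zero_angle_locus F1 F2 a b =
     {SO2_rel [F1, F2] `` {x} | x. x \<in> joint_configs [F1, F2] \<and> norm (terminal [F1, F2] x) = \<bar>a - b\<bar>}"
    unfolding zero_angle_locus_eq[OF ab] by (metis (no_types, lifting))
  then show ?thesis using double assms(6) by simp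
qed

end
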